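(* Let $(\xi_t,X_\tau)$ be a cyclic-independent conjugate process and let $\mu$ be a diffraction of $(\xi_t)$. If the sequence $(\xi_t)$ is $\mathbb{P}$-ergodic, in the sense that $\lim_{n\to\infty}n^{-1}\sum_{t=1}^n\xi_t=\mathbb{E}\xi_0$ in probability (in $M_1(\mathbb{R})$), then, as $n\to\infty$, (i) $\big\|n^{-1}\sum_{t=1}^nF_t-\mathbb{E}F_0\big\|=o_{\mathbb{P}}(1)$; (ii) $\big\|\widehat{\mathbb{E}}F_0-\mathbb{E}F_0\big\|=o_{\mathbb{P}}(1)$. If moreover $\big\|n^{-1}\sum_{t=1}^nF_t-\mathbb{E}F_0\big\|=O_{\mathbb{P}}(n^{-1/2})$, then $\big\|\widehat{\mathbb{E}}F_0-\mathbb{E}F_0\big\|=O_{\mathbb{P}}(n^{-1/2})$.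
   Context: Let $(\Omega,\mathscr{A},\mathbb{P})$ be a probability space and $M_1(\mathbb{R})$ the set of Borel probability measures on $\mathbb{R}$ with the topology of weak convergence (metrized by the Lévy–Prohorov metric). Standing assumption: $(\xi_t:t=0,1,\dots)$ is a (strictly) stationary sequence of random elements of $M_1(\mathbb{R})$. Put $\Xi:=\sigma(\xi_0,\xi_1,\dots)$. The baricenter $\mathbb{E}\xi_0$ is the unique element of $M_1(\mathbb{R})$ with $\mathbb{E}\int f\,d\xi_0=\int f\,d\mathbb{E}\xi_0$ for all continuous bounded $f$. Conjugate process: a pair $(\xi_t,X_\tau)$ where $(X_\tau:\tau\ge0)$ is a real-valued process such that for every Borel $B$, every $t=0,1,\dots$ and $\tau\in[t,t+1)$, $\mathbb{P}[X_\tau\in B\mid\Xi]=\xi_t(B)$ a.s. It is cyclic-independent if, conditionally on $\Xi$, the processes $(X_\tau:\tau\in[t,t+1))$, $t=0,1,\dots$, form an independent sequence. A finite Borel measure $\mu$ on $\mathbb{R}$ is a diffraction of $(\xi_t)$ if it is equivalent (mutually absolutely continuous) to Lebesgue measure on some interval containing the support of $\mathbb{E}\xi_0$; $\|\cdot\|$ is the norm of $L^2(\mu)$. Put $F_t(x):=\xi_t(-\infty,x]$ and $\mathbb{E}F_0(x):=\mathbb{E}\xi_0(-\infty,x]$. Sampling: in each cycle $t$ one observes $X_{1t},\dots,X_{q_t,t}$ ($q_t\ge1$), which are values $X_\tau$ of the process at $q_t$ times $\tau\in[t,t+1)$. Put $\widehat F_t(x):=\frac1{q_t}\sum_{i=1}^{q_t}\mathbb{I}_{[X_{it}\le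 x]}$ and $\widehat{\mathbb{E}}F_0(x):=\frac1n\sum_{t=1}^n\widehat F_t(x)$. *)

theory Defs
  imports "HOL-Probability.Probability"
begin

text \<open>
  The measurable space of Borel probability measures on the line is
  \<^term>\<open>prob_algebra borel :: real measure measure\<close>. Its sigma-algebra is generated by the
  evaluations \<open>\<mu> \<mapsto> \<mu>(B)\<close>; since the real line is a separable metric space, this is the Borel
  sigma-algebra of the topology of weak convergence.
\<close>

definition levy_prokhorov :: "'b::metric_space measure \<Rightarrow> 'b measure \<Rightarrow> real" where
  "levy_prokhorov \<mu> \<nu> =
     Inf {\<epsilon>. 0 < \<epsilon> \<and> (\<forall>A\<in>sets borel.
            measure \<mu> A \<le> measure \<nu> (\<Union>a\<in>A. ball a \<epsilon>) + \<epsilon> \<and>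
            measure \<nu> A \<le> measure \<mu> (\<Union>a\<in>A. ball a \<epsilon>) + \<epsilon>)}"

definition stationary_process :: "'a measure \<Rightarrow> 'b measure \<Rightarrow> (nat \<Rightarrow> 'a \<Rightarrow> 'b) \<Rightarrow> bool" where
  "stationary_process M N \<xi> \<longleftrightarrow>
     (\<forall>t. \<xi> t \<in> measurable M N) \<and>
     distr M (\<Pi>\<^sub>M t\<in>UNIV. N) (\<lambda>\<omega> t. \<xi> (Suc t) \<omega>) = distr M (\<Pi>\<^sub>M t\<in>UNIV. N) (\<lambda>\<omega> t. \<xi> t \<omega>)"

definition baricenter :: "'a measure \<Rightarrow> ('a \<Rightarrow> real measure) \<Rightarrow> real measure" where
  "baricenter M \<zeta> =
     (THE m. m \<in> space (prob_algebra borel) \<and>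
        (\<forall>f::real \<Rightarrow> real. continuous_on UNIV f \<longrightarrow> bounded (range f) \<longrightarrow>
           (\<integral>\<omega>. (\<integral>x. f x \<partial>\<zeta> \<omega>) \<partial>M) = (\<integral>x. f x \<partial>m)))"

definition average_measure :: "(nat \<Rightarrow> real measure) \<Rightarrow> nat \<Rightarrow> real measure" where
  "average_measure \<nu> n =
     measure_of UNIV (sets borel) (\<lambda>B. (\<Sum>t=1..n. emeasure (\<nu> t) B) / of_nat n)"

lemma sets_average_measure [simp, measurable_cong]: "sets (average_measure \<nu> n) = sets borel"
  using sets.sigma_sets_eq[of "borel :: real measure"] by (simp add: average_measure_def)

lemma space_average_measure [simp]: "space (average_measure \<nu> n) = UNIV"
  by (simp add: average_measure_def)

lemma emeasure_average_measure:
  assumes "\<And>t. sets (\<nu> t) = sets borel" and B: "B \<in> sets borel"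
  shows "emeasure (average_measure \<nu> n) B = (\<Sum>t=1..n. emeasure (\<nu> t) B) / of_nat n"
  unfolding average_measure_def
proof (rule emeasure_measure_of_sigma[OF _ _ _ B])
  show "sigma_algebra UNIV (sets (borel :: real measure))"
    using sets.sigma_algebra_axioms[of "borel :: real measure"] by simp
  show "positive (sets borel) (\<lambda>B. (\<Sum>t=1..n. emeasure (\<nu> t) B) / of_nat n)"
    by (simp add: positive_def)
  show "countably_additive (sets borel) (\<lambda>B. (\<Sum>t=1..n. emeasure (\<nu> t) B) / of_nat n)"
    unfolding countably_additive_def
  proof (intro allI impI)
    fix A :: "nat \<Rightarrow> real set"
    assume A: "range A \<subseteq> sets borel" "disjoint_family A"
    have "(\<Sum>i. (\<Sum>t=1..n. emeasure (\<nu> t) (A i)) / of_nat n) =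
          (\<Sum>i. \<Sum>t=1..n. emeasure (\<nu> t) (A i)) / of_nat n"
      by (simp add: divide_ennreal_def)
    also have "(\<Sum>i. \<Sum>t=1..n. emeasure (\<nu> t) (A i)) = (\<Sum>t=1..n. \<Sum>i. emeasure (\<nu> t) (A i))"
      by (rule suminf_sum) simp
    also have "\<dots> = (\<Sum>t=1..n. emeasure (\<nu> t) (\<Union>i. A i))"
      using A assms(1) by (intro sum.cong refl suminf_emeasure) auto
    finally show "(\<Sum>i. (\<Sum>t=1..n. emeasure (\<nu> t) (A i)) / of_nat n) =
        (\<Sum>t=1..n. emeasure (\<nu> t) (\<Union>i. A i)) / of_nat n" .
  qed
qed

definition generated_algebra :: "'a measure \<Rightarrow> 'b measure \<Rightarrow> (nat \<Rightarrow> 'a \<Rightarrow> 'b) \<Rightarrow> 'a measure" where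
  "generated_algebra M N \<xi> = vimage_algebra (space M) (\<lambda>\<omega> t. \<xi> t \<omega>) (\<Pi>\<^sub>M t\<in>UNIV. N)"

definition cond_prob_given :: "'a measure \<Rightarrow> 'a measure \<Rightarrow> 'a set \<Rightarrow> 'a \<Rightarrow> real" where
  "cond_prob_given M F A = real_cond_exp M F (indicator A)"

definition cond_indep_vars ::
    "'a measure \<Rightarrow> 'a measure \<Rightarrow> ('i \<Rightarrow> 'b measure) \<Rightarrow> ('i \<Rightarrow> 'a \<Rightarrow> 'b) \<Rightarrow> 'i set \<Rightarrow> bool" where
  "cond_indep_vars M F N Y I \<longleftrightarrow>
     (\<forall>i\<in>I. Y i \<in> measurable M (N i)) \<and>
     (\<forall>J\<subseteq>I. J \<noteq> {} \<longrightarrow> finite J \<longrightarrow> (\<forall>A\<in>(\<Pi> j\<in>J. sets (N j)).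
        AE \<omega> in M. cond_prob_given M F (\<Inter>j\<in>J. Y j -` A j \<inter> space M) \<omega> =
                   (\<Prod>j\<in>J. cond_prob_given M F (Y j -` A j \<inter> space M) \<omega>)))"

definition conjugate_process ::
    "'a measure \<Rightarrow> (nat \<Rightarrow> 'a \<Rightarrow> real measure) \<Rightarrow> (real \<Rightarrow> 'a \<Rightarrow> real) \<Rightarrow> bool" where
  "conjugate_process M \<xi> X \<longleftrightarrow>
     (\<forall>\<tau>\<ge>0. X \<tau> \<in> borel_measurable M) \<and>
     (\<forall>B\<in>sets borel. \<forall>t. \<forall>\<tau>\<in>{real t..<real t + 1}.
        AE \<omega> in M. cond_prob_given M (generated_algebra M (prob_algebra borel) \<xi>)
                     (X \<tau> -` B \<inter> space M) \<omega> = measure (\<xi> t \<omega>) B)"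

definition cyclic_independent ::
    "'a measure \<Rightarrow> (nat \<Rightarrow> 'a \<Rightarrow> real measure) \<Rightarrow> (real \<Rightarrow> 'a \<Rightarrow> real) \<Rightarrow> bool" where
  "cyclic_independent M \<xi> X \<longleftrightarrow>
     cond_indep_vars M (generated_algebra M (prob_algebra borel) \<xi>)
       (\<lambda>t. \<Pi>\<^sub>M \<tau>\<in>{real t..<real t + 1}. borel)
       (\<lambda>t \<omega>. \<lambda>\<tau>\<in>{real t..<real t + 1}. X \<tau> \<omega>) (UNIV :: nat set)"

definition measure_support :: "'b::topological_space measure \<Rightarrow> 'b set" where
  "measure_support m = {x. \<forall>U. open U \<longrightarrow> x \<in> U \<longrightarrow> 0 < emeasure m U}"

definition diffraction :: "'a measure \<Rightarrow> (nat \<Rightarrow> 'a \<Rightarrow> real measure) \<Rightarrow> real measure \<Rightarrow> bool" where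
  "diffraction M \<xi> \<mu> \<longleftrightarrow>
     sets \<mu> = sets borel \<and> finite_measure \<mu> \<and>
     (\<exists>I. is_interval I \<and> measure_support (baricenter M (\<xi> 0)) \<subseteq> I \<and>
        absolutely_continuous \<mu> (density lborel (indicator I)) \<and>
        absolutely_continuous (density lborel (indicator I)) \<mu>)"

definition L2_norm :: "'b measure \<Rightarrow> ('b \<Rightarrow> real) \<Rightarrow> real" where
  "L2_norm \<mu> f = sqrt (\<integral>x. (f x)\<^sup>2 \<partial>\<mu>)"

text \<open>
  Outer measure coincides with the measure on measurable events. It is used so that no event is
  assigned probability 0 merely for not being (known to be) measurable.
\<close>

definition small_o_P :: "'a measure \<Rightarrow> (nat \<Rightarrow> 'a \<Rightarrow> real) \<Rightarrow> (nat \<Rightarrow> real) \<Rightarrow> bool" where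
  "small_o_P M Z a \<longleftrightarrow>
     (\<forall>\<epsilon>>0. (\<lambda>n. outer_measure_of M {\<omega>\<in>space M. \<epsilon> * a n < \<bar>Z n \<omega>\<bar>}) \<longlonglongrightarrow> 0)"

definition big_O_P :: "'a measure \<Rightarrow> (nat \<Rightarrow> 'a \<Rightarrow> real) \<Rightarrow> (nat \<Rightarrow> real) \<Rightarrow> bool" where
  "big_O_P M Z a \<longleftrightarrow>
     (\<forall>\<epsilon>>0. \<exists>C>0. \<forall>\<^sub>F n in sequentially.
        outer_measure_of M {\<omega>\<in>space M. C * a n < \<bar>Z n \<omega>\<bar>} < ennreal \<epsilon>)"

definition ergodic_in_prob :: "'a measure \<Rightarrow> (nat \<Rightarrow> 'a \<Rightarrow> real measure) \<Rightarrow> bool" where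
  "ergodic_in_prob M \<xi> \<longleftrightarrow>
     small_o_P M (\<lambda>n \<omega>. levy_prokhorov (average_measure (\<lambda>t. \<xi> t \<omega>) n) (baricenter M (\<xi> 0))) (\<lambda>_. 1)"

definition mean_cdf :: "(nat \<Rightarrow> 'a \<Rightarrow> real measure) \<Rightarrow> nat \<Rightarrow> 'a \<Rightarrow> real \<Rightarrow> real" where
  "mean_cdf \<xi> n \<omega> x = (\<Sum>t=1..n. cdf (\<xi> t \<omega>) x) / real n"

text \<open>In cycle \<open>t\<close> the process is observed at the times \<open>s t 1, \<dots>, s t (q t)\<close>.\<close>

definition sample_cdf ::
    "(real \<Rightarrow> 'a \<Rightarrow> real) \<Rightarrow> (nat \<Rightarrow> nat) \<Rightarrow> (nat \<Rightarrow> nat \<Rightarrow> real) \<Rightarrow> nat \<Rightarrow> 'a \<Rightarrow> real \<Rightarrow> real" where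
  "sample_cdf X q s t \<omega> x = (\<Sum>i=1..q t. indicator {..x} (X (s t i) \<omega>)) / real (q t)"

definition mean_sample_cdf ::
    "(real \<Rightarrow> 'a \<Rightarrow> real) \<Rightarrow> (nat \<Rightarrow> nat) \<Rightarrow> (nat \<Rightarrow> nat \<Rightarrow> real) \<Rightarrow> nat \<Rightarrow> 'a \<Rightarrow> real \<Rightarrow> real" where
  "mean_sample_cdf X q s n \<omega> x = (\<Sum>t=1..n. sample_cdf X q s t \<omega> x) / real n"

end

theory Submission
  imports Defs
begin

text \<open>
  The error of the empirical estimator splits as the sum of a sampling error
  \<open>n\<^sup>-\<^sup>1 \<Sum> (sample_cdf t - F\<^sub>t)\<close> and the ergodic error \<open>n\<^sup>-\<^sup>1 \<Sum> F\<^sub>t - EF\<^sub>0\<close>.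

  The ergodic error is small because a measure that is close to \<open>E\<xi>\<^sub>0\<close> in the Levy-Prokhorov metric
  has a distribution function that is close to \<open>EF\<^sub>0\<close> away from the atoms of \<open>E\<xi>\<^sub>0\<close>. The atoms are
  countably many, hence Lebesgue-null, hence null for the diffraction \<open>\<mu>\<close>, and distribution functions
  are bounded while \<open>\<mu>\<close> is finite. So \<open>levy_prokhorov_imp_L2_norm_cdf_small\<close> bounds the \<open>L\<^sup>2(\<mu>)\<close>
  norm pathwise, and \<open>small_o_P_mean_cdf\<close> carries over the convergence in probability.

  The sampling error is \<open>O\<^sub>P(n\<^sup>-\<^sup>1\<^sup>/\<^sup>2)\<close> without any ergodicity. Conditionally on the process of
  distributions, the errors of different cycles are centred and independent, so at every \<open>x\<close> they
  are uncorrelated (\<open>sampling_errors_uncorrelated\<close>). They are bounded by 1, so the mean square of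
  their average is at most \<open>1 / n\<close>, and integrating over \<open>\<mu>\<close> bounds the mean squared norm by
  \<open>\<mu>(\<real>) / n\<close> (\<open>big_O_P_L2_norm_average_uncorrelated\<close>). Both claims on the empirical estimator
  follow from the triangle inequality.
\<close>

section \<open>The baricenter of a random measure\<close>

lemma real_distribution_iff_prob_algebra:
  "real_distribution P \<longleftrightarrow> P \<in> space (prob_algebra borel)"
  by (auto simp: space_prob_algebra real_distribution_def real_distribution_axioms_def)

lemma real_distribution_eqI_integral:
  assumes P: "real_distribution P" and Q: "real_distribution Q"
    and eq: "\<And>f::real \<Rightarrow> real. continuous_on UNIV f \<Longrightarrow> bounded (range f) \<Longrightarrow>
               (\<integral>x. f x \<partial>P) = (\<integral>x. f x \<partial>Q)"
  shows "P = Q"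
proof (rule Levy_uniqueness[OF P Q])
  have char: "char R t = Complex (\<integral>x. cos (t * x) \<partial>R) (\<integral>x. sin (t * x) \<partial>R)"
    if "real_distribution R" for R t
  proof -
    interpret real_distribution R by fact
    have "integrable R (\<lambda>x. iexp (t * x))"
      by (rule integrable_iexp) auto
    then show ?thesis
      unfolding char_def
      by (intro complex_eqI) (simp_all add: integral_Re[symmetric] integral_Im[symmetric] Re_exp Im_exp)
  qed
  show "char P = char Q"
  proof
    fix t :: real
    have "bounded (range (\<lambda>x. cos (t * x)))" "bounded (range (\<lambda>x. sin (t * x)))"
      by (auto simp: bounded_iff intro!: exI[of _ 1])
    then show "char P t = char Q t"
      unfolding char[OF P] char[OF Q] by (intro arg_cong2[of _ _ _ _ Complex] eq continuous_intros)
  qed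
qed

text \<open>
  The mixture of \<open>\<zeta>\<close> under \<open>M\<close>, which is the bind of the Giry monad, satisfies the defining
  equation of the baricenter. It is the only solution because the characteristic function is an
  integral of bounded continuous functions, and it determines the distribution.
\<close>

lemma real_distribution_baricenter:
  assumes "prob_space M" and \<zeta>: "\<zeta> \<in> M \<rightarrow>\<^sub>M prob_algebra borel"
  shows "real_distribution (baricenter M \<zeta>)"
proof -
  interpret prob_space M by fact
  have \<zeta>': "\<zeta> \<in> M \<rightarrow>\<^sub>M subprob_algebra borel"
    using \<zeta> by (rule measurable_prob_algebraD)
  have M: "M \<in> space (prob_algebra M)"
    by (simp add: space_prob_algebra prob_space_axioms)
  let ?m = "M \<bind> \<zeta>"
  have m: "?m \<in> space (prob_algebra borel)"
    using prob_space_bind'[OF M \<zeta>] sets_bind'[OF M \<zeta>] by (simp add: space_prob_algebra)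
  have int: "(\<integral>\<omega>. (\<integral>x. f x \<partial>\<zeta> \<omega>) \<partial>M) = (\<integral>x. f x \<partial>?m)"
    if f: "continuous_on UNIV f" "bounded (range f)" for f :: "real \<Rightarrow> real"
  proof -
    from f(2) obtain B where B: "\<And>x. \<bar>f x\<bar> \<le> B" by (auto simp: bounded_iff)
    have "f \<in> borel_measurable borel" using f(1) by (rule borel_measurable_continuous_onI)
    moreover have "AE \<omega> in M. emeasure (\<zeta> \<omega>) (space (\<zeta> \<omega>)) \<le> ennreal 1"
    proof (rule AE_I2)
      fix \<omega> assume "\<omega> \<in> space M"
      then have "prob_space (\<zeta> \<omega>)"
        using measurable_space[OF \<zeta>] by (auto simp: space_prob_algebra)
      then show "emeasure (\<zeta> \<omega>) (space (\<zeta> \<omega>)) \<le> ennreal 1"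
        by (simp add: prob_space.emeasure_space_1)
    qed
    ultimately have "(\<integral>x. f x \<partial>?m) = (\<integral>\<omega>. (\<integral>x. f x \<partial>\<zeta> \<omega>) \<partial>M)"
      by (intro integral_bind[where K=borel and B=B and B'=1])
         (auto simp: B \<zeta>' finite_measure_axioms)
    then show ?thesis by simp
  qed
  have "baricenter M \<zeta> \<in> space (prob_algebra borel) \<and>
    (\<forall>f::real \<Rightarrow> real. continuous_on UNIV f \<longrightarrow> bounded (range f) \<longrightarrow>
           (\<integral>\<omega>. (\<integral>x. f x \<partial>\<zeta> \<omega>) \<partial>M) = (\<integral>x. f x \<partial>baricenter M \<zeta>))"
    unfolding baricenter_def
  proof (rule theI[of _ ?m])
    show "?m \<in> space (prob_algebra borel) \<and>
      (\<forall>f::real \<Rightarrow> real. continuous_on UNIV f \<longrightarrow> bounded (range f) \<longrightarrow>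
           (\<integral>\<omega>. (\<integral>x. f x \<partial>\<zeta> \<omega>) \<partial>M) = (\<integral>x. f x \<partial>?m))"
      using m int by blast
  next
    fix m' assume m': "m' \<in> space (prob_algebra borel) \<and>
      (\<forall>f::real \<Rightarrow> real. continuous_on UNIV f \<longrightarrow> bounded (range f) \<longrightarrow>
           (\<integral>\<omega>. (\<integral>x. f x \<partial>\<zeta> \<omega>) \<partial>M) = (\<integral>x. f x \<partial>m'))"
    show "m' = ?m"
    proof (rule real_distribution_eqI_integral)
      show "real_distribution m'" "real_distribution ?m"
        using m' m by (auto simp: real_distribution_iff_prob_algebra)
      fix f :: "real \<Rightarrow> real" assume "continuous_on UNIV f" "bounded (range f)"
      with m' int[of f] show "(\<integral>x. f x \<partial>m') = (\<integral>x. f x \<partial>?m)" by simp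
    qed
  qed
  then show ?thesis by (simp add: real_distribution_iff_prob_algebra)
qed

section \<open>Distribution functions of measures close in the Levy-Prokhorov metric\<close>

lemma levy_prokhorov_imp_cdf_close:
  assumes P: "real_distribution P" and Q: "real_distribution Q" and less: "levy_prokhorov P Q < \<epsilon>"
  shows "\<bar>cdf P x - cdf Q x\<bar> \<le> \<epsilon> + (cdf Q (x + \<epsilon>) - cdf Q (x - \<epsilon>))"
proof -
  interpret P: real_distribution P by fact
  interpret Q: real_distribution Q by fact
  let ?S = "{\<epsilon>. 0 < \<epsilon> \<and> (\<forall>A\<in>sets borel.
            measure P A \<le> measure Q (\<Union>a\<in>A. ball a \<epsilon>) + \<epsilon> \<and>
            measure Q A \<le> measure P (\<Union>a\<in>A. ball a \<epsilon>) + \<epsilon>)}"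
  \<comment> \<open>The set is nonempty, so its infimum is not an arbitrary default value.\<close>
  have "1 \<in> ?S"
    by (auto intro!: order_trans[OF P.prob_le_1] order_trans[OF Q.prob_le_1])
  then have "?S \<noteq> {}" by blast
  moreover have "Inf ?S < \<epsilon>" using less by (simp add: levy_prokhorov_def)
  ultimately obtain e where e: "e \<in> ?S" "e < \<epsilon>" using cInf_lessD[of ?S \<epsilon>] by blast
  have "cdf P x \<le> measure Q (\<Union>a\<in>{..x}. ball a e) + e"
    using e(1) by (simp add: cdf_def)
  also have "measure Q (\<Union>a\<in>{..x}. ball a e) \<le> cdf Q (x + \<epsilon>)"
    unfolding cdf_def using e by (intro Q.finite_measure_mono) (auto simp: dist_real_def)
  finally have up: "cdf P x \<le> cdf Q (x + \<epsilon>) + \<epsilon>" using e by simp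
  have "cdf Q (x - e) \<le> measure P (\<Union>a\<in>{..x - e}. ball a e) + e"
    using e(1) by (simp add: cdf_def)
  also have "measure P (\<Union>a\<in>{..x - e}. ball a e) \<le> cdf P x"
    unfolding cdf_def using e by (intro P.finite_measure_mono) (auto simp: dist_real_def)
  finally have lo: "cdf Q (x - e) \<le> cdf P x + \<epsilon>" using e by simp
  have "cdf Q (x - \<epsilon>) \<le> cdf Q (x - e)" "cdf Q (x - \<epsilon>) \<le> cdf Q x" "cdf Q x \<le> cdf Q (x + \<epsilon>)"
    using e by (auto intro!: Q.cdf_nondecreasing)
  with up lo show ?thesis by linarith
qed

lemma L2_norm_nonneg [simp]: "0 \<le> L2_norm \<mu> f"
  by (simp add: L2_norm_def)

lemma (in real_distribution) borel_measurable_cdf [measurable]: "cdf M \<in> borel_measurable borel"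
  by (rule borel_measurable_mono) (auto simp: mono_def cdf_nondecreasing)

lemma (in real_distribution) cdf_le_1: "cdf M x \<le> 1"
  by (simp add: cdf_def)

text \<open>
  The right-hand side of \<open>levy_prokhorov_imp_cdf_close\<close> tends to zero with \<open>\<epsilon>\<close> at every \<open>x\<close> that is
  not an atom of \<open>Q\<close>. There are countably many atoms, so this is \<open>\<mu>\<close>-almost everywhere, and
  dominated convergence makes its norm in \<open>L\<^sup>2(\<mu>)\<close> small. Since it depends on \<open>Q\<close> and \<open>\<epsilon>\<close> only,
  the bound is uniform in \<open>P\<close>.
\<close>

lemma levy_prokhorov_imp_L2_norm_cdf_small:
  assumes "finite_measure \<mu>" and sets [measurable_cong]: "sets \<mu> = sets borel"
    and null: "\<And>A. countable A \<Longrightarrow> A \<in> null_sets \<mu>"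
    and Q: "real_distribution Q" and "0 < \<delta>"
  obtains \<epsilon> where "0 < \<epsilon>"
    "\<And>P. real_distribution P \<Longrightarrow> levy_prokhorov P Q < \<epsilon> \<Longrightarrow>
       L2_norm \<mu> (\<lambda>x. cdf P x - cdf Q x) < \<delta>"
proof -
  interpret \<mu>: finite_measure \<mu> by fact
  interpret Q: real_distribution Q by fact
  define e where "e k = 1 / real (Suc k)" for k
  define h where "h k x = (e k + (cdf Q (x + e k) - cdf Q (x - e k)))\<^sup>2" for k x
  have e: "0 < e k" "e k \<le> 1" for k by (simp_all add: e_def)
  have e0: "e \<longlonglongrightarrow> 0" unfolding e_def by (rule LIMSEQ_Suc[OF lim_1_over_n])
  have [measurable]: "h k \<in> borel_measurable borel" for k
    unfolding h_def by measurable
  have base: "0 \<le> e k + (cdf Q (x + e k) - cdf Q (x - e k))"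
    "e k + (cdf Q (x + e k) - cdf Q (x - e k)) \<le> 2" for k x
  proof -
    have "cdf Q (x - e k) \<le> cdf Q (x + e k)"
      using e[of k] by (intro Q.cdf_nondecreasing) linarith
    then show "0 \<le> e k + (cdf Q (x + e k) - cdf Q (x - e k))"
      "e k + (cdf Q (x + e k) - cdf Q (x - e k)) \<le> 2"
      using e[of k] Q.cdf_le_1[of "x + e k"] Q.cdf_nonneg[of "x - e k"] by linarith+
  qed
  have h_bound: "\<bar>h k x\<bar> \<le> 4" for k x
    using power_mono[OF base(2) base(1), of k x 2] by (simp add: h_def)
  have cont: "AE x in \<mu>. isCont (cdf Q) x"
  proof -
    have "{x. 0 < measure Q {x}} \<in> null_sets \<mu>" by (intro null Q.countable_atoms)
    from AE_not_in[OF this] show ?thesis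
      by eventually_elim (auto simp: Q.isCont_cdf zero_less_measure_iff)
  qed
  have "(\<lambda>k. \<integral>x. h k x \<partial>\<mu>) \<longlonglongrightarrow> (\<integral>x. 0 \<partial>\<mu>)"
  proof (rule integral_dominated_convergence[where w="\<lambda>_. 4"])
    show "AE x in \<mu>. (\<lambda>k. h k x) \<longlonglongrightarrow> 0"
      using cont
    proof eventually_elim
      fix x assume cont: "isCont (cdf Q) x"
      have "(\<lambda>k. x + e k) \<longlonglongrightarrow> x" "(\<lambda>k. x - e k) \<longlonglongrightarrow> x"
        using tendsto_add[OF tendsto_const e0, of x] tendsto_diff[OF tendsto_const e0, of x] by simp_all
      then have "(\<lambda>k. cdf Q (x + e k)) \<longlonglongrightarrow> cdf Q x" "(\<lambda>k. cdf Q (x - e k)) \<longlonglongrightarrow> cdf Q x"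
        by (auto intro: isCont_tendsto_compose[OF cont])
      then have "(\<lambda>k. h k x) \<longlonglongrightarrow> (0 + (cdf Q x - cdf Q x))\<^sup>2"
        unfolding h_def by (intro tendsto_intros e0)
      then show "(\<lambda>k. h k x) \<longlonglongrightarrow> 0" by simp
    qed
  qed (use h_bound in auto)
  then have "(\<lambda>k. \<integral>x. h k x \<partial>\<mu>) \<longlonglongrightarrow> 0" by simp
  moreover have "0 < \<delta>\<^sup>2" using \<open>0 < \<delta>\<close> by simp
  ultimately have "\<forall>\<^sub>F k in sequentially. (\<integral>x. h k x \<partial>\<mu>) < \<delta>\<^sup>2" by (rule order_tendstoD)
  then obtain k where k: "(\<integral>x. h k x \<partial>\<mu>) < \<delta>\<^sup>2"
    using eventually_happens'[OF sequentially_bot] by blast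
  show ?thesis
  proof (rule that[OF e(1)[of k]])
    fix P assume P: "real_distribution P" and LP: "levy_prokhorov P Q < e k"
    interpret P: real_distribution P by fact
    have le: "(cdf P x - cdf Q x)\<^sup>2 \<le> h k x" for x
      using levy_prokhorov_imp_cdf_close[OF P Q LP, of x] base(1)[of k x]
      unfolding h_def by (simp flip: abs_le_square_iff)
    have int: "integrable \<mu> (h k)"
      using h_bound by (intro \<mu>.integrable_const_bound[where B=4]) auto
    have "(\<integral>x. (cdf P x - cdf Q x)\<^sup>2 \<partial>\<mu>) \<le> (\<integral>x. h k x \<partial>\<mu>)"
      using int le by (rule integral_mono') (simp add: h_def)
    then have "sqrt (\<integral>x. (cdf P x - cdf Q x)\<^sup>2 \<partial>\<mu>) < sqrt (\<delta>\<^sup>2)"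
      using k by (intro real_sqrt_less_mono) linarith
    then show "L2_norm \<mu> (\<lambda>x. cdf P x - cdf Q x) < \<delta>"
      using \<open>0 < \<delta>\<close> by (simp add: L2_norm_def)
  qed
qed

lemma diffraction_countable_null:
  assumes "diffraction M \<xi> \<mu>" and "countable A"
  shows "A \<in> null_sets \<mu>"
proof -
  obtain I where I: "absolutely_continuous (density lborel (indicator I)) \<mu>" "is_interval (I::real set)"
    using assms(1) by (auto simp: diffraction_def)
  have [measurable]: "I \<in> sets borel" using I(2) by (rule real_interval_borel_measurable)
  have "A \<in> null_sets lborel" using assms(2) by (rule countable_imp_null_set_lborel)
  then have "A \<in> null_sets (density lborel (indicator I))"
    using AE_not_in[of A lborel]
    by (subst null_sets_density_iff) (auto elim: eventually_mono)
  with I(1) show ?thesis by (auto simp: absolutely_continuous_def)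
qed

lemma real_distribution_average_measure:
  assumes \<nu>: "\<And>t. real_distribution (\<nu> t)" and "1 \<le> n"
  shows "real_distribution (average_measure \<nu> n)"
proof -
  have s: "sets (\<nu> t) = sets borel" for t
    using \<nu>[of t] by (simp add: real_distribution_iff_prob_algebra space_prob_algebra)
  have "emeasure (\<nu> t) UNIV = 1" for t
    using prob_space.emeasure_space_1[of "\<nu> t"] \<nu>[of t] real_distribution.space_eq_univ[OF \<nu>[of t]]
    by (simp add: real_distribution_def)
  then have "emeasure (average_measure \<nu> n) UNIV = 1"
    using assms(2)
    by (simp add: emeasure_average_measure[OF s] ennreal_of_nat_eq_real_of_nat divide_ennreal)
  then show ?thesis
    by (simp add: real_distribution_iff_prob_algebra space_prob_algebra prob_spaceI)
qed

lemma cdf_average_measure: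
  assumes \<nu>: "\<And>t. real_distribution (\<nu> t)" and n: "1 \<le> n"
  shows "cdf (average_measure \<nu> n) x = (\<Sum>t=1..n. cdf (\<nu> t) x) / real n"
proof -
  have s: "sets (\<nu> t) = sets borel" for t
    using \<nu>[of t] by (simp add: real_distribution_iff_prob_algebra space_prob_algebra)
  have em: "emeasure (\<nu> t) {..x} = ennreal (cdf (\<nu> t) x)" for t
  proof -
    interpret real_distribution "\<nu> t" by (rule \<nu>)
    show ?thesis by (simp add: cdf_def emeasure_eq_measure)
  qed
  have nn: "0 \<le> cdf (\<nu> t) x" for t by (simp add: cdf_def)
  have "emeasure (average_measure \<nu> n) {..x} = ennreal ((\<Sum>t=1..n. cdf (\<nu> t) x) / real n)"
    using n by (simp add: emeasure_average_measure[OF s] em nn sum_nonneg divide_ennreal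
                  ennreal_of_nat_eq_real_of_nat)
  then show ?thesis using nn by (simp add: cdf_def measure_def sum_nonneg)
qed

section \<open>Stochastic orders of magnitude\<close>

lemma outer_measure_of_Un:
  assumes "A \<subseteq> space M" "B \<subseteq> space M"
  shows "outer_measure_of M (A \<union> B) \<le> outer_measure_of M A + outer_measure_of M B"
proof -
  obtain E F where E: "E \<in> sets M" "A \<subseteq> E" "outer_measure_of M A = emeasure M E"
    and F: "F \<in> sets M" "B \<subseteq> F" "outer_measure_of M B = emeasure M F"
    using outer_measure_of_attain[OF assms(1)] outer_measure_of_attain[OF assms(2)] by blast
  have "outer_measure_of M (A \<union> B) \<le> outer_measure_of M (E \<union> F)"
    using E F by (intro outer_measure_of_mono) blast
  also have "\<dots> \<le> emeasure M E + emeasure M F"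
    using E F by (simp add: emeasure_subadditive)
  finally show ?thesis by (simp add: E F)
qed

text \<open>
  The triangle inequality is used in the weak form \<open>|Z| \<le> 2 max |U| |V|\<close>: orders of magnitude do
  not depend on the constant, and in \<open>L\<^sup>2\<close> this form follows from \<open>(f + g)\<^sup>2 \<le> 2 f\<^sup>2 + 2 g\<^sup>2\<close>.
\<close>

lemma outer_measure_exceeds_quasi_triangle:
  fixes U V Z :: "'a \<Rightarrow> real"
  assumes "\<And>\<omega>. \<omega> \<in> space M \<Longrightarrow> \<bar>Z \<omega>\<bar> \<le> 2 * max \<bar>U \<omega>\<bar> \<bar>V \<omega>\<bar>"
  shows "outer_measure_of M {\<omega>\<in>space M. 2 * c < \<bar>Z \<omega>\<bar>} \<le>
    outer_measure_of M {\<omega>\<in>space M. c < \<bar>U \<omega>\<bar>} + outer_measure_of M {\<omega>\<in>space M. c < \<bar>V \<omega>\<bar>}"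
proof -
  have "outer_measure_of M {\<omega>\<in>space M. 2 * c < \<bar>Z \<omega>\<bar>} \<le>
    outer_measure_of M ({\<omega>\<in>space M. c < \<bar>U \<omega>\<bar>} \<union> {\<omega>\<in>space M. c < \<bar>V \<omega>\<bar>})"
    using assms by (intro outer_measure_of_mono) (force simp: max_def split: if_splits dest: order.strict_trans2)
  also have "\<dots> \<le> outer_measure_of M {\<omega>\<in>space M. c < \<bar>U \<omega>\<bar>} + outer_measure_of M {\<omega>\<in>space M. c < \<bar>V \<omega>\<bar>}"
    by (intro outer_measure_of_Un) auto
  finally show ?thesis .
qed

lemma small_o_P_quasi_triangle:
  assumes Z: "\<And>n \<omega>. \<omega> \<in> space M \<Longrightarrow> \<bar>Z n \<omega>\<bar> \<le> 2 * max \<bar>U n \<omega>\<bar> \<bar>V n \<omega>\<bar>"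
    and U: "small_o_P M U a" and V: "small_o_P M V a"
  shows "small_o_P M Z a"
  unfolding small_o_P_def
proof (intro allI impI)
  fix \<epsilon> :: real assume "0 < \<epsilon>"
  let ?p = "\<lambda>W n. outer_measure_of M {\<omega>\<in>space M. \<epsilon> / 2 * a n < \<bar>W n \<omega>\<bar>}"
  have "(\<lambda>n. ?p U n + ?p V n) \<longlonglongrightarrow> 0 + 0"
    using U V \<open>0 < \<epsilon>\<close> unfolding small_o_P_def by (intro tendsto_add) (auto dest!: spec[of _ "\<epsilon> / 2"])
  then have lim: "(\<lambda>n. ?p U n + ?p V n) \<longlonglongrightarrow> 0" by simp
  show "(\<lambda>n. outer_measure_of M {\<omega>\<in>space M. \<epsilon> * a n < \<bar>Z n \<omega>\<bar>}) \<longlonglongrightarrow> 0"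
  proof (rule tendsto_sandwich[OF _ _ tendsto_const lim])
    show "\<forall>\<^sub>F n in sequentially. outer_measure_of M {\<omega>\<in>space M. \<epsilon> * a n < \<bar>Z n \<omega>\<bar>} \<le> ?p U n + ?p V n"
    proof (rule always_eventually, rule allI)
      fix n
      show "outer_measure_of M {\<omega>\<in>space M. \<epsilon> * a n < \<bar>Z n \<omega>\<bar>} \<le> ?p U n + ?p V n"
        using outer_measure_exceeds_quasi_triangle[OF Z, of M "\<lambda>\<omega>. \<omega>" "\<epsilon> / 2 * a n" "\<lambda>_. n"] by simp
    qed
  qed simp
qed

lemma big_O_P_quasi_triangle:
  assumes Z: "\<And>n \<omega>. \<omega> \<in> space M \<Longrightarrow> \<bar>Z n \<omega>\<bar> \<le> 2 * max \<bar>U n \<omega>\<bar> \<bar>V n \<omega>\<bar>"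
    and a: "\<And>n. 0 \<le> a n"
    and U: "big_O_P M U a" and V: "big_O_P M V a"
  shows "big_O_P M Z a"
  unfolding big_O_P_def
proof (intro allI impI)
  fix \<epsilon> :: real assume "0 < \<epsilon>"
  let ?p = "\<lambda>W C n. outer_measure_of M {\<omega>\<in>space M. C * a n < \<bar>W n \<omega>\<bar>}"
  from U V \<open>0 < \<epsilon>\<close> obtain C D where "0 < C" "0 < D"
    and C: "\<forall>\<^sub>F n in sequentially. ?p U C n < ennreal (\<epsilon> / 2)"
    and D: "\<forall>\<^sub>F n in sequentially. ?p V D n < ennreal (\<epsilon> / 2)"
    unfolding big_O_P_def by (meson half_gt_zero)
  define K where "K = max C D"
  have mono: "?p W K n \<le> ?p W C' n" if "C' \<le> K" for W n C'
  proof (rule outer_measure_of_mono, clarsimp)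
    fix \<omega> assume "K * a n < \<bar>W n \<omega>\<bar>"
    then show "C' * a n < \<bar>W n \<omega>\<bar>"
      using mult_right_mono[OF that a[of n]] by linarith
  qed
  have "\<forall>\<^sub>F n in sequentially. ?p Z (2 * K) n < ennreal \<epsilon>"
    using C D
  proof eventually_elim
    fix n assume n: "?p U C n < ennreal (\<epsilon> / 2)" "?p V D n < ennreal (\<epsilon> / 2)"
    have "?p Z (2 * K) n \<le> ?p U K n + ?p V K n"
      using outer_measure_exceeds_quasi_triangle[OF Z, where c="K * a n"] by (simp add: mult.assoc)
    also have "\<dots> < ennreal (\<epsilon> / 2 + \<epsilon> / 2)"
    proof (rule add_mono_ennreal)
      show "?p U K n < ennreal (\<epsilon> / 2)"
        using mono[where W=U and C'=C and n=n] n(1) by (intro le_less_trans[of "?p U K n"]) (simp_all add: K_def)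
      show "?p V K n < ennreal (\<epsilon> / 2)"
        using mono[where W=V and C'=D and n=n] n(2) by (intro le_less_trans[of "?p V K n"]) (simp_all add: K_def)
    qed
    also have "\<dots> = ennreal \<epsilon>" by simp
    finally show "?p Z (2 * K) n < ennreal \<epsilon>" .
  qed
  moreover have "0 < 2 * K" using \<open>0 < C\<close> by (simp add: K_def)
  ultimately show "\<exists>C>0. \<forall>\<^sub>F n in sequentially. ?p Z C n < ennreal \<epsilon>" by blast
qed

lemma big_O_P_imp_small_o_P:
  assumes U: "big_O_P M U a" and a: "a \<longlonglongrightarrow> 0"
  shows "small_o_P M U (\<lambda>_. 1)"
  unfolding small_o_P_def
proof (intro allI impI)
  fix \<epsilon> :: real assume "0 < \<epsilon>"
  let ?p = "\<lambda>n. outer_measure_of M {\<omega>\<in>space M. \<epsilon> * 1 < \<bar>U n \<omega>\<bar>}"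
  show "?p \<longlonglongrightarrow> 0"
  proof (rule order_tendstoI)
    fix y :: ennreal assume "0 < y"
    then obtain z where z: "0 < z" "z < y" using dense by blast
    then have "z = ennreal (enn2real z)" by (intro ennreal_enn2real[symmetric]) (auto intro: order.strict_trans2)
    with z obtain \<eta> where \<eta>: "0 < \<eta>" "ennreal \<eta> < y"
      by (metis ennreal_less_zero_iff)
    with U obtain C where "0 < C" and C:
      "\<forall>\<^sub>F n in sequentially. outer_measure_of M {\<omega>\<in>space M. C * a n < \<bar>U n \<omega>\<bar>} < ennreal \<eta>"
      unfolding big_O_P_def by blast
    have "(\<lambda>n. C * a n) \<longlonglongrightarrow> 0" using tendsto_mult[OF tendsto_const a, of C] by simp
    then have "\<forall>\<^sub>F n in sequentially. C * a n < \<epsilon>" using \<open>0 < \<epsilon>\<close> by (rule order_tendstoD)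
    with C show "\<forall>\<^sub>F n in sequentially. ?p n < y"
    proof eventually_elim
      fix n assume n: "outer_measure_of M {\<omega>\<in>space M. C * a n < \<bar>U n \<omega>\<bar>} < ennreal \<eta>" "C * a n < \<epsilon>"
      have "?p n \<le> outer_measure_of M {\<omega>\<in>space M. C * a n < \<bar>U n \<omega>\<bar>}"
        using n(2) by (intro outer_measure_of_mono) auto
      also note n(1)
      also note \<eta>(2)
      finally show "?p n < y" .
    qed
  qed simp
qed

lemma L2_norm_add_quasi_triangle:
  assumes f: "integrable \<mu> (\<lambda>x. (f x)\<^sup>2)" and g: "integrable \<mu> (\<lambda>x. (g x)\<^sup>2)"
  shows "L2_norm \<mu> (\<lambda>x. f x + g x) \<le> 2 * max (L2_norm \<mu> f) (L2_norm \<mu> g)"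
proof -
  let ?m = "max (L2_norm \<mu> f) (L2_norm \<mu> g)"
  have sq: "(\<integral>x. (h x)\<^sup>2 \<partial>\<mu>) = (L2_norm \<mu> h)\<^sup>2" for h by (simp add: L2_norm_def)
  have le: "(L2_norm \<mu> f)\<^sup>2 \<le> ?m\<^sup>2" "(L2_norm \<mu> g)\<^sup>2 \<le> ?m\<^sup>2"
    by (intro power_mono; simp)+
  have "(\<integral>x. (f x + g x)\<^sup>2 \<partial>\<mu>) \<le> (\<integral>x. 2 * (f x)\<^sup>2 + 2 * (g x)\<^sup>2 \<partial>\<mu>)"
  proof (rule integral_mono')
    fix x
    have "0 \<le> (f x - g x)\<^sup>2" by simp
    then show "(f x + g x)\<^sup>2 \<le> 2 * (f x)\<^sup>2 + 2 * (g x)\<^sup>2" by (simp add: power2_eq_square algebra_simps)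
  qed (use f g in auto)
  also have "\<dots> = 2 * (L2_norm \<mu> f)\<^sup>2 + 2 * (L2_norm \<mu> g)\<^sup>2"
    using f g by (simp add: sq)
  also have "\<dots> \<le> (2 * ?m)\<^sup>2" using le by (simp add: power_mult_distrib)
  finally have "sqrt (\<integral>x. (f x + g x)\<^sup>2 \<partial>\<mu>) \<le> sqrt ((2 * ?m)\<^sup>2)" by (rule real_sqrt_le_mono)
  also have "\<dots> = 2 * ?m" by (subst real_sqrt_abs) (simp add: le_max_iff_disj)
  finally show ?thesis by (simp add: L2_norm_def)
qed

section \<open>Averages of bounded uncorrelated random functions\<close>

lemma abs_average_le_1:
  fixes g :: "nat \<Rightarrow> real"
  assumes "\<And>t. \<bar>g t\<bar> \<le> 1"
  shows "\<bar>(\<Sum>t=1..n. g t) / real n\<bar> \<le> 1"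
proof -
  have "\<bar>\<Sum>t=1..n. g t\<bar> \<le> (\<Sum>t=1..n. 1)"
    using assms by (intro order_trans[OF sum_abs] sum_mono)
  then show ?thesis by (cases "n = 0") (auto simp: divide_simps)
qed

lemma second_moment_average_uncorrelated:
  fixes D :: "nat \<Rightarrow> 'a \<Rightarrow> real"
  assumes "prob_space M" and [measurable]: "\<And>t. D t \<in> borel_measurable M"
    and bound: "\<And>t \<omega>. \<omega> \<in> space M \<Longrightarrow> \<bar>D t \<omega>\<bar> \<le> 1"
    and uncor: "\<And>t u. t \<noteq> u \<Longrightarrow> (\<integral>\<omega>. D t \<omega> * D u \<omega> \<partial>M) = 0"
    and n: "1 \<le> n"
  shows "(\<integral>\<omega>. ((\<Sum>t=1..n. D t \<omega>) / real n)\<^sup>2 \<partial>M) \<le> 1 / real n"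
proof -
  interpret prob_space M by fact
  have prod: "\<bar>D t \<omega> * D u \<omega>\<bar> \<le> 1" if "\<omega> \<in> space M" for t u \<omega>
    using mult_mono[OF bound[OF that, of t] bound[OF that, of u]] by (simp add: abs_mult)
  have int: "integrable M (\<lambda>\<omega>. D t \<omega> * D u \<omega>)" for t u
    using prod by (intro integrable_const_bound[where B=1]) auto
  have diag: "(\<integral>\<omega>. D t \<omega> * D t \<omega> \<partial>M) \<le> 1" for t
    using prod[of _ t t] by (intro integral_le_const int AE_I2) auto
  have "(\<integral>\<omega>. ((\<Sum>t=1..n. D t \<omega>) / real n)\<^sup>2 \<partial>M)
      = (\<integral>\<omega>. (\<Sum>t=1..n. \<Sum>u=1..n. D t \<omega> * D u \<omega>) / (real n)\<^sup>2 \<partial>M)"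
    by (simp add: power2_eq_square sum_product)
  also have "\<dots> = (\<Sum>t=1..n. \<Sum>u=1..n. \<integral>\<omega>. D t \<omega> * D u \<omega> \<partial>M) / (real n)\<^sup>2"
    using int by simp
  also have "(\<Sum>t=1..n. \<Sum>u=1..n. \<integral>\<omega>. D t \<omega> * D u \<omega> \<partial>M) = (\<Sum>t=1..n. \<integral>\<omega>. D t \<omega> * D t \<omega> \<partial>M)"
  proof (rule sum.cong[OF refl])
    fix t assume t: "t \<in> {1..n}"
    have "(\<Sum>u=1..n. \<integral>\<omega>. D t \<omega> * D u \<omega> \<partial>M) = (\<Sum>u\<in>{t}. \<integral>\<omega>. D t \<omega> * D u \<omega> \<partial>M)"
      using t uncor by (intro sum.mono_neutral_right) auto
    then show "(\<Sum>u=1..n. \<integral>\<omega>. D t \<omega> * D u \<omega> \<partial>M) = (\<integral>\<omega>. D t \<omega> * D t \<omega> \<partial>M)" by simp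
  qed
  also have "\<dots> / (real n)\<^sup>2 \<le> real n / (real n)\<^sup>2"
    using sum_bounded_above[of "{1..n}" "\<lambda>t. \<integral>\<omega>. D t \<omega> * D t \<omega> \<partial>M" 1] diag
    by (intro divide_right_mono) auto
  also have "\<dots> = 1 / real n" using n by (simp add: power2_eq_square)
  finally show ?thesis .
qed

text \<open>
  By Fubini the mean of the squared norm of the average is the integral over \<open>x\<close> of second moments,
  each at most \<open>1 / n\<close>; Markov's inequality then gives the rate.
\<close>

lemma big_O_P_L2_norm_average_uncorrelated:
  fixes D :: "nat \<Rightarrow> 'a \<Rightarrow> real \<Rightarrow> real" and \<mu> :: "real measure"
  assumes "prob_space M" and "finite_measure \<mu>" and sets_\<mu> [measurable_cong]: "sets \<mu> = sets borel"
    and meas [measurable]: "\<And>t. case_prod (D t) \<in> borel_measurable (M \<Otimes>\<^sub>M borel)"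
    and bound: "\<And>t \<omega> x. \<omega> \<in> space M \<Longrightarrow> \<bar>D t \<omega> x\<bar> \<le> 1"
    and uncor: "\<And>t u x. t \<noteq> u \<Longrightarrow> (\<integral>\<omega>. D t \<omega> x * D u \<omega> x \<partial>M) = 0"
  shows "big_O_P M (\<lambda>n \<omega>. L2_norm \<mu> (\<lambda>x. (\<Sum>t=1..n. D t \<omega> x) / real n)) (\<lambda>n. 1 / sqrt (real n))"
proof -
  interpret prob_space M by fact
  interpret \<mu>: finite_measure \<mu> by fact
  interpret P: pair_sigma_finite M \<mu> ..
  define m where "m = measure \<mu> UNIV"
  have space_\<mu>: "space \<mu> = UNIV" using sets_eq_imp_space_eq[OF sets_\<mu>] by simp
  have [simp]: "0 \<le> m" by (simp add: m_def)
  define W where "W n \<omega> x = ((\<Sum>t=1..n. D t \<omega> x) / real n)\<^sup>2" for n \<omega> x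
  have W_meas [measurable]: "case_prod (W n) \<in> borel_measurable (M \<Otimes>\<^sub>M borel)" for n
    unfolding W_def by measurable
  have W_bound: "\<bar>W n \<omega> x\<bar> \<le> 1" if "\<omega> \<in> space M" for n \<omega> x
  proof -
    have "\<bar>(\<Sum>t=1..n. D t \<omega> x) / real n\<bar> \<le> 1"
      using bound[OF that] by (rule abs_average_le_1)
    then show ?thesis unfolding W_def by (simp add: abs_square_le_1)
  qed
  have "finite_measure (M \<Otimes>\<^sub>M \<mu>)"
    by (intro finite_measure_pair_measure finite_measure_axioms \<mu>.finite_measure_axioms)
  then interpret MP: finite_measure "M \<Otimes>\<^sub>M \<mu>" .
  have W_int: "integrable (M \<Otimes>\<^sub>M \<mu>) (case_prod (W n))" for n
    using W_bound by (intro MP.integrable_const_bound[where B=1]) (auto simp: space_pair_measure)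
  have mean: "(\<integral>\<omega>. (\<integral>x. W n \<omega> x \<partial>\<mu>) \<partial>M) \<le> m / real n" if n: "1 \<le> n" for n
  proof -
    have "(\<integral>\<omega>. (\<integral>x. W n \<omega> x \<partial>\<mu>) \<partial>M) = (\<integral>x. (\<integral>\<omega>. W n \<omega> x \<partial>M) \<partial>\<mu>)"
      using P.Fubini_integral[OF W_int] by simp
    also have "\<dots> \<le> (\<integral>x. 1 / real n \<partial>\<mu>)"
    proof (rule integral_mono')
      fix x
      show "(\<integral>\<omega>. W n \<omega> x \<partial>M) \<le> 1 / real n"
        unfolding W_def
        by (rule second_moment_average_uncorrelated[OF prob_space_axioms _ bound uncor n]) measurable
    qed auto
    finally show ?thesis by (simp add: m_def space_\<mu>)
  qed
  have tail: "outer_measure_of M {\<omega>\<in>space M. C * (1 / sqrt (real n)) <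
        \<bar>L2_norm \<mu> (\<lambda>x. (\<Sum>t=1..n. D t \<omega> x) / real n)\<bar>} \<le> ennreal (m / C\<^sup>2)"
    if "0 < C" and n: "1 \<le> n" for C n
  proof -
    have "outer_measure_of M {\<omega>\<in>space M. C * (1 / sqrt (real n)) <
        \<bar>L2_norm \<mu> (\<lambda>x. (\<Sum>t=1..n. D t \<omega> x) / real n)\<bar>}
      \<le> outer_measure_of M {\<omega>\<in>space M. C\<^sup>2 / real n \<le> (\<integral>x. W n \<omega> x \<partial>\<mu>)}"
    proof (rule outer_measure_of_mono, clarsimp)
      fix \<omega> assume "C / sqrt (real n) < L2_norm \<mu> (\<lambda>x. (\<Sum>t=Suc 0..n. D t \<omega> x) / real n)"
      then have "(C / sqrt (real n))\<^sup>2 \<le> (L2_norm \<mu> (\<lambda>x. (\<Sum>t=Suc 0..n. D t \<omega> x) / real n))\<^sup>2"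
        using \<open>0 < C\<close> by (intro power_mono) auto
      then show "C\<^sup>2 / real n \<le> (\<integral>x. W n \<omega> x \<partial>\<mu>)"
        by (simp add: L2_norm_def W_def power_divide)
    qed
    also have "\<dots> = emeasure M {\<omega>\<in>space M. C\<^sup>2 / real n \<le> (\<integral>x. W n \<omega> x \<partial>\<mu>)}"
      by (rule outer_measure_of_eq) measurable
    also have "\<dots> \<le> ennreal (1 / (C\<^sup>2 / real n) * (\<integral>\<omega>. (\<integral>x. W n \<omega> x \<partial>\<mu>) \<partial>M))"
    proof (rule integral_Markov_inequality)
      show "integrable M (\<lambda>\<omega>. \<integral>x. W n \<omega> x \<partial>\<mu>)" using P.integrable_fst'[OF W_int] by simp
      show "0 < C\<^sup>2 / real n" using that by simp
    qed (simp add: W_def)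
    also have "\<dots> \<le> ennreal (1 / (C\<^sup>2 / real n) * (m / real n))"
      using that by (intro ennreal_leI mult_left_mono mean) auto
    also have "1 / (C\<^sup>2 / real n) * (m / real n) = m / C\<^sup>2" using n by simp
    finally show ?thesis .
  qed
  show ?thesis
    unfolding big_O_P_def
  proof (intro allI impI)
    fix \<epsilon> :: real assume "0 < \<epsilon>"
    \<comment> \<open>Any \<open>C\<close> with \<open>m / C\<^sup>2 < \<epsilon>\<close> will do; adding 1 keeps it positive when \<open>\<mu>\<close> is zero.\<close>
    define C where "C = sqrt ((m + 1) / \<epsilon>)"
    have "0 < C" using \<open>0 < \<epsilon>\<close> by (simp add: C_def add_nonneg_pos)
    have "m / C\<^sup>2 < \<epsilon>" using \<open>0 < \<epsilon>\<close> \<open>0 \<le> m\<close> by (simp add: C_def divide_less_eq not_less)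
    then have "ennreal (m / C\<^sup>2) < ennreal \<epsilon>" using \<open>0 < \<epsilon>\<close> by (intro ennreal_lessI) auto
    then have "\<forall>\<^sub>F n in sequentially. outer_measure_of M {\<omega>\<in>space M. C * (1 / sqrt (real n)) <
        \<bar>L2_norm \<mu> (\<lambda>x. (\<Sum>t=1..n. D t \<omega> x) / real n)\<bar>} < ennreal \<epsilon>"
      by (intro eventually_sequentiallyI[of 1] le_less_trans[OF tail[OF \<open>0 < C\<close>]])
    with \<open>0 < C\<close> show "\<exists>C>0. \<forall>\<^sub>F n in sequentially. outer_measure_of M {\<omega>\<in>space M.
        C * (1 / sqrt (real n)) < \<bar>L2_norm \<mu> (\<lambda>x. (\<Sum>t=1..n. D t \<omega> x) / real n)\<bar>} < ennreal \<epsilon>"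
      by blast
  qed
qed

section \<open>Conditional independence across cycles\<close>

lemma subalgebra_generated_algebra:
  assumes "\<And>t. \<xi> t \<in> M \<rightarrow>\<^sub>M N"
  shows "subalgebra M (generated_algebra M N \<xi>)"
proof -
  have "(\<lambda>\<omega> t. \<xi> t \<omega>) \<in> M \<rightarrow>\<^sub>M (\<Pi>\<^sub>M t\<in>UNIV. N)"
    by (rule measurable_PiM_single') (use assms in \<open>auto simp: PiE_def dest: measurable_space\<close>)
  then show ?thesis
    unfolding subalgebra_def generated_algebra_def
    by (simp add: measurable_iff_sets)
qed

text \<open>
  If \<open>A\<close> and \<open>B\<close> are conditionally independent given \<open>F\<close>, then their indicators, centred at the
  conditional probabilities, are uncorrelated: all four terms of the expanded product integrate to
  the integral of \<open>a b\<close>. The functions \<open>a\<close> and \<open>b\<close> are versions of the conditional probabilities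
  which need not be \<open>F\<close>-measurable themselves.
\<close>

lemma integral_centered_product_cond_indep:
  fixes a b :: "'a \<Rightarrow> real"
  assumes "prob_space M" and "subalgebra M F"
    and [measurable]: "A \<in> sets M" "B \<in> sets M" "a \<in> borel_measurable M" "b \<in> borel_measurable M"
    and a_le: "\<And>\<omega>. \<omega> \<in> space M \<Longrightarrow> \<bar>a \<omega>\<bar> \<le> 1" and b_le: "\<And>\<omega>. \<omega> \<in> space M \<Longrightarrow> \<bar>b \<omega>\<bar> \<le> 1"
    and a: "AE \<omega> in M. cond_prob_given M F A \<omega> = a \<omega>"
    and b: "AE \<omega> in M. cond_prob_given M F B \<omega> = b \<omega>"
    and indep: "AE \<omega> in M. cond_prob_given M F (A \<inter> B) \<omega> = cond_prob_given M F A \<omega> * cond_prob_given M F B \<omega>"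
  shows "(\<integral>\<omega>. (indicator A \<omega> - a \<omega>) * (indicator B \<omega> - b \<omega>) \<partial>M) = 0"
proof -
  interpret prob_space M by fact
  interpret finite_measure_subalgebra M F by unfold_locales fact
  let ?P = "cond_prob_given M F"
  have [measurable]: "?P C \<in> borel_measurable F" "?P C \<in> borel_measurable M" for C
    by (simp_all add: cond_prob_given_def)
  have prod_le: "\<bar>x * y\<bar> \<le> 1" if "\<bar>x\<bar> \<le> 1" "\<bar>y\<bar> \<le> 1" for x y :: real
    using mult_mono[OF that] by (simp add: abs_mult)
  have int: "integrable M (\<lambda>\<omega>. f \<omega> * g \<omega>)"
    if [measurable]: "f \<in> borel_measurable M" "g \<in> borel_measurable M"
      and "\<And>\<omega>. \<omega> \<in> space M \<Longrightarrow> \<bar>f \<omega>\<bar> \<le> 1" "\<And>\<omega>. \<omega> \<in> space M \<Longrightarrow> \<bar>g \<omega>\<bar> \<le> 1" for f g :: "'a \<Rightarrow> real"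
    using that(3,4) by (intro integrable_const_bound[where B=1]) (auto intro!: prod_le)
  have ind_le: "\<bar>indicator C \<omega> :: real\<bar> \<le> 1" for C and \<omega> :: 'a by (simp add: indicator_def)
  have AB: "(\<integral>\<omega>. indicator A \<omega> * indicator B \<omega> \<partial>M) = (\<integral>\<omega>. a \<omega> * b \<omega> \<partial>M)"
  proof -
    have "(\<integral>\<omega>. indicator A \<omega> * indicator B \<omega> \<partial>M) = (\<integral>\<omega>. (indicator (A \<inter> B) \<omega> :: real) \<partial>M)"
      by (simp add: indicator_inter_arith)
    also have "\<dots> = (\<integral>\<omega>. ?P (A \<inter> B) \<omega> \<partial>M)"
      unfolding cond_prob_given_def by (intro real_cond_exp_int(2)[symmetric] integrable_const_bound[where B=1])
         (auto simp: ind_le)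
    also have "\<dots> = (\<integral>\<omega>. a \<omega> * b \<omega> \<partial>M)"
      using indep a b by (intro integral_cong_AE) auto
    finally show ?thesis .
  qed
  have cross: "(\<integral>\<omega>. c \<omega> * indicator C \<omega> \<partial>M) = (\<integral>\<omega>. c \<omega> * d \<omega> \<partial>M)"
    if [measurable]: "C \<in> sets M" "C' \<in> sets M" "c \<in> borel_measurable M" "d \<in> borel_measurable M"
      and c_le: "\<And>\<omega>. \<omega> \<in> space M \<Longrightarrow> \<bar>c \<omega>\<bar> \<le> 1"
      and c: "AE \<omega> in M. ?P C' \<omega> = c \<omega>" and d: "AE \<omega> in M. ?P C \<omega> = d \<omega>"
    for C C' and c d :: "'a \<Rightarrow> real"
  proof -
    have "(\<integral>\<omega>. c \<omega> * indicator C \<omega> \<partial>M) = (\<integral>\<omega>. ?P C' \<omega> * indicator C \<omega> \<partial>M)"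
      using c by (intro integral_cong_AE) auto
    also have "\<dots> = (\<integral>\<omega>. ?P C' \<omega> * ?P C \<omega> \<partial>M)"
      \<comment> \<open>The first factor is measurable for \<open>F\<close>, so the second may be replaced by its
        conditional expectation.\<close>
      unfolding cond_prob_given_def[of _ _ C]
    proof (rule real_cond_exp_intg(2)[symmetric])
      show "integrable M (\<lambda>\<omega>. ?P C' \<omega> * indicator C \<omega>)"
        using c c_le by (intro integrable_const_bound[where B=1]) (auto intro!: prod_le ind_le)
    qed auto
    also have "\<dots> = (\<integral>\<omega>. c \<omega> * d \<omega> \<partial>M)" using c d by (intro integral_cong_AE) auto
    finally show ?thesis .
  qed
  have "(\<integral>\<omega>. (indicator A \<omega> - a \<omega>) * (indicator B \<omega> - b \<omega>) \<partial>M)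
     = (\<integral>\<omega>. indicator A \<omega> * indicator B \<omega> - a \<omega> * indicator B \<omega> - b \<omega> * indicator A \<omega> + a \<omega> * b \<omega> \<partial>M)"
    by (intro Bochner_Integration.integral_cong) (auto simp: algebra_simps)
  also have "\<dots> = (\<integral>\<omega>. indicator A \<omega> * indicator B \<omega> \<partial>M) - (\<integral>\<omega>. a \<omega> * indicator B \<omega> \<partial>M)
      - (\<integral>\<omega>. b \<omega> * indicator A \<omega> \<partial>M) + (\<integral>\<omega>. a \<omega> * b \<omega> \<partial>M)"
    by (simp add: int a_le b_le ind_le)
  also have "\<dots> = 0"
    using AB cross[of B A a b] cross[of A B b a] a_le b_le a b by (simp add: mult.commute)
  finally show ?thesis .
qed

lemma cyclic_independent_events:
  assumes ind: "cyclic_independent M \<xi> X" and "t \<noteq> u"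
    and \<tau>: "\<tau> \<in> {real t..<real t + 1}" and \<sigma>: "\<sigma> \<in> {real u..<real u + 1}"
    and B: "B \<in> sets borel" and C: "C \<in> sets borel"
  defines "P \<equiv> cond_prob_given M (generated_algebra M (prob_algebra borel) \<xi>)"
  shows "AE \<omega> in M. P ((X \<tau> -` B \<inter> space M) \<inter> (X \<sigma> -` C \<inter> space M)) \<omega> =
           P (X \<tau> -` B \<inter> space M) \<omega> * P (X \<sigma> -` C \<inter> space M) \<omega>"
proof -
  define I where "I k = {real k..<real k + 1}" for k
  define Y where "Y k \<omega> = (\<lambda>\<tau>\<in>I k. X \<tau> \<omega>)" for k \<omega>
  define E where "E \<rho> S k = (\<lambda>f. f \<rho>) -` S \<inter> space (\<Pi>\<^sub>M \<tau>\<in>I k. (borel :: real measure))"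
    for \<rho> :: real and S :: "real set" and k
  \<comment> \<open>Each event about one observation is a cylinder event of the path over its whole cycle.\<close>
  define A where "A k = (if k = t then E \<tau> B t else E \<sigma> C u)" for k
  have E: "E \<rho> S k \<in> sets (\<Pi>\<^sub>M \<tau>\<in>I k. borel)" if "\<rho> \<in> I k" "S \<in> sets borel" for \<rho> S k
    unfolding E_def using that by (intro measurable_sets[OF measurable_component_singleton]) auto
  have vim: "Y k -` E \<rho> S k \<inter> space M = X \<rho> -` S \<inter> space M" if "\<rho> \<in> I k" for \<rho> S k
    using that by (auto simp: E_def Y_def space_PiM)
  have A_in: "A \<in> (\<Pi> j\<in>{t,u}. sets (\<Pi>\<^sub>M \<tau>\<in>I j. borel))"
    using E[of \<tau> t B] E[of \<sigma> u C] \<tau> \<sigma> B C \<open>t \<noteq> u\<close> by (auto simp: A_def I_def)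
  have all: "\<forall>J\<subseteq>UNIV. J \<noteq> {} \<longrightarrow> finite J \<longrightarrow> (\<forall>A\<in>(\<Pi> j\<in>J. sets (\<Pi>\<^sub>M \<tau>\<in>I j. borel)).
      AE \<omega> in M. P (\<Inter>j\<in>J. Y j -` A j \<inter> space M) \<omega> = (\<Prod>j\<in>J. P (Y j -` A j \<inter> space M) \<omega>))"
    using ind unfolding cyclic_independent_def cond_indep_vars_def P_def Y_def I_def by (rule conjunct2)
  have "AE \<omega> in M. P (\<Inter>j\<in>{t,u}. Y j -` A j \<inter> space M) \<omega> = (\<Prod>j\<in>{t,u}. P (Y j -` A j \<inter> space M) \<omega>)"
    by (rule all[rule_format, OF _ _ _ A_in]) auto
  then show ?thesis
    using \<open>t \<noteq> u\<close> \<tau> \<sigma> vim[of \<tau> t B] vim[of \<sigma> u C] by (simp add: A_def I_def)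
qed

text \<open>
  Joint measurability in \<open>\<omega>\<close> and \<open>x\<close>, which the exchange of integrals over \<open>M\<close> and \<open>\<mu>\<close> requires.
\<close>

lemma borel_measurable_random_cdf:
  assumes "\<zeta> \<in> M \<rightarrow>\<^sub>M prob_algebra borel"
  shows "(\<lambda>(\<omega>, x). cdf (\<zeta> \<omega>) x) \<in> borel_measurable (M \<Otimes>\<^sub>M borel)"
proof -
  have "(\<lambda>p. measure (\<zeta> (fst p)) {..snd p}) \<in> borel_measurable (M \<Otimes>\<^sub>M borel)"
  proof (rule measure_measurable_prob_algebra2)
    have "(SIGMA p:space (M \<Otimes>\<^sub>M borel). {..snd p}) = 
        {r \<in> space ((M \<Otimes>\<^sub>M borel) \<Otimes>\<^sub>M borel). snd r \<le> snd (fst r)}"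
      by (auto simp: space_pair_measure)
    also have "\<dots> \<in> sets ((M \<Otimes>\<^sub>M borel) \<Otimes>\<^sub>M (borel :: real measure))" by measurable
    finally show "(SIGMA p:space (M \<Otimes>\<^sub>M borel). {..snd p}) \<in> sets ((M \<Otimes>\<^sub>M borel) \<Otimes>\<^sub>M (borel :: real measure))" .
    show "(\<lambda>p. \<zeta> (fst p)) \<in> M \<Otimes>\<^sub>M borel \<rightarrow>\<^sub>M prob_algebra borel"
      using assms by measurable
  qed
  then show ?thesis by (simp add: cdf_def split_beta')
qed

section \<open>Sampling errors and ergodic averages\<close>

lemma sample_cdf_bounds:
  "0 \<le> sample_cdf X q s t \<omega> x" "sample_cdf X q s t \<omega> x \<le> 1"
proof -
  have "(\<Sum>i=1..q t. indicator {..x} (X (s t i) \<omega>)) \<le> (\<Sum>i=1..q t. 1 :: real)"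
    by (intro sum_mono) (simp add: indicator_def)
  then show "0 \<le> sample_cdf X q s t \<omega> x" "sample_cdf X q s t \<omega> x \<le> 1"
    unfolding sample_cdf_def by (auto simp: sum_nonneg divide_le_eq_1)
qed

lemma borel_measurable_sample_cdf:
  assumes "\<And>i. i \<in> {1..q t} \<Longrightarrow> X (s t i) \<in> borel_measurable M"
  shows "(\<lambda>(\<omega>, x). sample_cdf X q s t \<omega> x) \<in> borel_measurable (M \<Otimes>\<^sub>M borel)"
proof -
  have "(\<lambda>p. \<Sum>i=1..q t. if X (s t i) (fst p) \<le> snd p then 1 else 0 :: real)
      \<in> borel_measurable (M \<Otimes>\<^sub>M borel)"
  proof (rule borel_measurable_sum)
    fix i assume "i \<in> {1..q t}"
    then have [measurable]: "X (s t i) \<in> borel_measurable M" by (rule assms)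
    show "(\<lambda>p. if X (s t i) (fst p) \<le> snd p then 1 else 0 :: real) \<in> borel_measurable (M \<Otimes>\<^sub>M borel)"
      by measurable
  qed
  then have "(\<lambda>p. (\<Sum>i=1..q t. if X (s t i) (fst p) \<le> snd p then 1 else 0) / real (q t))
      \<in> borel_measurable (M \<Otimes>\<^sub>M borel)"
    by measurable
  then show ?thesis
    by (simp add: sample_cdf_def indicator_def split_beta' of_bool_def)
qed

text \<open>
  At a fixed \<open>x\<close> the errors of the empirical distribution functions of two cycles are averages of
  centred indicators \<open>e k i\<close>, the conditional mean of the indicator being \<open>F\<^sub>k(x)\<close> for every
  observation time within cycle \<open>k\<close>. Observations within one cycle may be dependent in any way.
\<close>

lemma sampling_errors_uncorrelated:
  fixes M :: "'a measure" and \<xi> :: "nat \<Rightarrow> 'a \<Rightarrow> real measure"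
  assumes "prob_space M" and \<xi>: "\<And>t. \<xi> t \<in> M \<rightarrow>\<^sub>M prob_algebra borel"
    and conj: "conjugate_process M \<xi> X" and ind: "cyclic_independent M \<xi> X"
    and q: "\<And>t. 1 \<le> q t"
    and s: "\<And>t i. i \<in> {1..q t} \<Longrightarrow> s t i \<in> {real t..<real t + 1}"
    and "t \<noteq> u"
  shows "(\<integral>\<omega>. (sample_cdf X q s t \<omega> x - cdf (\<xi> t \<omega>) x) * (sample_cdf X q s u \<omega> x - cdf (\<xi> u \<omega>) x) \<partial>M) = 0"
proof -
  interpret prob_space M by fact
  let ?F = "generated_algebra M (prob_algebra borel) \<xi>"
  define e where "e k i \<omega> = indicator {..x} (X (s k i) \<omega>) - cdf (\<xi> k \<omega>) x" for k i \<omega>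
  have F_meas [measurable]: "(\<lambda>\<omega>. cdf (\<xi> k \<omega>) x) \<in> borel_measurable M" for k
    using measurable_compose[OF measurable_Pair2' borel_measurable_random_cdf[OF \<xi>[of k]], of x] by simp
  have F_le: "\<bar>cdf (\<xi> k \<omega>) x\<bar> \<le> 1" if "\<omega> \<in> space M" for k \<omega>
  proof -
    have "real_distribution (\<xi> k \<omega>)"
      using measurable_space[OF \<xi> that] by (simp add: real_distribution_iff_prob_algebra)
    from real_distribution.cdf_le_1[OF this] show ?thesis by (simp add: cdf_def)
  qed
  have X: "X (s k i) \<in> borel_measurable M" if "i \<in> {1..q k}" for k i
    using conj s[OF that] by (auto simp: conjugate_process_def)
  have ind_eq: "indicator (X \<tau> -` {..x} \<inter> space M) \<omega> = (indicator {..x} (X \<tau> \<omega>) :: real)"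
    if "\<omega> \<in> space M" for \<tau> \<omega> using that by (simp add: indicator_def)
  have e_meas [measurable]: "e k i \<in> borel_measurable M" if "i \<in> {1..q k}" for k i
  proof -
    note [measurable] = X[OF that]
    show ?thesis unfolding e_def by measurable
  qed
  have e_le: "\<bar>e k i \<omega>\<bar> \<le> 1" if "\<omega> \<in> space M" for k i \<omega>
    using F_le[OF that, of k] by (auto simp: e_def indicator_def cdf_def)
  have int: "integrable M (\<lambda>\<omega>. e t i \<omega> * e u j \<omega>)" if "i \<in> {1..q t}" "j \<in> {1..q u}" for i j
    using that by (intro integrable_const_bound[where B=1]) (auto simp: abs_mult intro!: mult_le_one e_le)
  have zero: "(\<integral>\<omega>. e t i \<omega> * e u j \<omega> \<partial>M) = 0" if i: "i \<in> {1..q t}" and j: "j \<in> {1..q u}" for i j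
  proof -
    let ?A = "X (s t i) -` {..x} \<inter> space M" and ?B = "X (s u j) -` {..x} \<inter> space M"
    have cond: "AE \<omega> in M. cond_prob_given M ?F (X (s k l) -` {..x} \<inter> space M) \<omega> = cdf (\<xi> k \<omega>) x"
      if "l \<in> {1..q k}" for k l
      using conj s[OF that] unfolding conjugate_process_def cdf_def by simp
    have "(\<integral>\<omega>. (indicator ?A \<omega> - cdf (\<xi> t \<omega>) x) * (indicator ?B \<omega> - cdf (\<xi> u \<omega>) x) \<partial>M) = 0"
    proof (rule integral_centered_product_cond_indep[OF prob_space_axioms])
      show "subalgebra M ?F" using \<xi> by (rule subalgebra_generated_algebra)
      show "?A \<in> sets M" "?B \<in> sets M" using X[OF i] X[OF j] by (auto intro: measurable_sets)
      show "AE \<omega> in M. cond_prob_given M ?F (?A \<inter> ?B) \<omega> =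
          cond_prob_given M ?F ?A \<omega> * cond_prob_given M ?F ?B \<omega>"
        using ind \<open>t \<noteq> u\<close> s[OF i] s[OF j] by (rule cyclic_independent_events) auto
    qed (use F_le cond[OF i] cond[OF j] in auto)
    then show ?thesis
      unfolding e_def by (subst (asm) Bochner_Integration.integral_cong[OF refl]) (auto simp: ind_eq)
  qed
  have D: "sample_cdf X q s k \<omega> x - cdf (\<xi> k \<omega>) x = (\<Sum>i=1..q k. e k i \<omega>) / real (q k)" for k \<omega>
    using q[of k] by (simp add: sample_cdf_def e_def sum_subtractf diff_divide_distrib)
  have "(\<integral>\<omega>. (sample_cdf X q s t \<omega> x - cdf (\<xi> t \<omega>) x) * (sample_cdf X q s u \<omega> x - cdf (\<xi> u \<omega>) x) \<partial>M)
     = (\<integral>\<omega>. (\<Sum>i=1..q t. \<Sum>j=1..q u. e t i \<omega> * e u j \<omega>) / (real (q t) * real (q u)) \<partial>M)"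
    by (simp add: D sum_product)
  also have "\<dots> = (\<integral>\<omega>. (\<Sum>i=1..q t. \<Sum>j=1..q u. e t i \<omega> * e u j \<omega>) \<partial>M) / (real (q t) * real (q u))"
    by simp
  also have "(\<integral>\<omega>. (\<Sum>i=1..q t. \<Sum>j=1..q u. e t i \<omega> * e u j \<omega>) \<partial>M)
      = (\<Sum>i=1..q t. \<integral>\<omega>. (\<Sum>j=1..q u. e t i \<omega> * e u j \<omega>) \<partial>M)"
    by (intro Bochner_Integration.integral_sum Bochner_Integration.integrable_sum int)
  also have "\<dots> = (\<Sum>i=1..q t. \<Sum>j=1..q u. \<integral>\<omega>. e t i \<omega> * e u j \<omega> \<partial>M)"
    by (intro sum.cong refl Bochner_Integration.integral_sum int)
  also have "\<dots> / (real (q t) * real (q u)) = 0" using zero by simp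
  finally show ?thesis .
qed

lemma small_o_P_mean_cdf:
  assumes \<xi>: "\<And>t. \<xi> t \<in> M \<rightarrow>\<^sub>M prob_algebra borel" and m: "real_distribution m"
    and fin: "finite_measure \<mu>" and sets: "sets \<mu> = sets borel"
    and null: "\<And>A. countable A \<Longrightarrow> A \<in> null_sets \<mu>"
    and LP: "small_o_P M (\<lambda>n \<omega>. levy_prokhorov (average_measure (\<lambda>t. \<xi> t \<omega>) n) m) (\<lambda>_. 1)"
  shows "small_o_P M (\<lambda>n \<omega>. L2_norm \<mu> (\<lambda>x. mean_cdf \<xi> n \<omega> x - cdf m x)) (\<lambda>n. 1)"
  unfolding small_o_P_def
proof (intro allI impI)
  fix \<delta> :: real assume "0 < \<delta>"
  obtain \<epsilon> where "0 < \<epsilon>" and \<epsilon>: "\<And>P. real_distribution P \<Longrightarrow> levy_prokhorov P m < \<epsilon> \<Longrightarrow>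
      L2_norm \<mu> (\<lambda>x. cdf P x - cdf m x) < \<delta>"
    using levy_prokhorov_imp_L2_norm_cdf_small[OF fin sets null m \<open>0 < \<delta>\<close>] by blast
  let ?LP = "\<lambda>n \<omega>. levy_prokhorov (average_measure (\<lambda>t. \<xi> t \<omega>) n) m"
  have lim: "(\<lambda>n. outer_measure_of M {\<omega>\<in>space M. \<epsilon> / 2 * 1 < \<bar>?LP n \<omega>\<bar>}) \<longlonglongrightarrow> 0"
    using LP \<open>0 < \<epsilon>\<close> unfolding small_o_P_def by (meson half_gt_zero)
  show "(\<lambda>n. outer_measure_of M {\<omega>\<in>space M. \<delta> * 1 <
      \<bar>L2_norm \<mu> (\<lambda>x. mean_cdf \<xi> n \<omega> x - cdf m x)\<bar>}) \<longlonglongrightarrow> 0"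
  proof (rule tendsto_sandwich[OF _ _ tendsto_const lim])
    show "\<forall>\<^sub>F n in sequentially.
        outer_measure_of M {\<omega>\<in>space M. \<delta> * 1 < \<bar>L2_norm \<mu> (\<lambda>x. mean_cdf \<xi> n \<omega> x - cdf m x)\<bar>}
        \<le> outer_measure_of M {\<omega>\<in>space M. \<epsilon> / 2 * 1 < \<bar>?LP n \<omega>\<bar>}"
    proof (intro eventually_sequentiallyI[of 1] outer_measure_of_mono Collect_mono impI, elim conjE, intro conjI)
      fix n \<omega> assume n: "1 \<le> n" and \<omega>: "\<omega> \<in> space M"
        and gt: "\<delta> * 1 < \<bar>L2_norm \<mu> (\<lambda>x. mean_cdf \<xi> n \<omega> x - cdf m x)\<bar>"
      have dist: "real_distribution (\<xi> t \<omega>)" for t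
        using measurable_space[OF \<xi> \<omega>] by (simp add: real_distribution_iff_prob_algebra)
      have "mean_cdf \<xi> n \<omega> = cdf (average_measure (\<lambda>t. \<xi> t \<omega>) n)"
        using cdf_average_measure[where \<nu>="\<lambda>t. \<xi> t \<omega>", OF dist n] by (simp add: mean_cdf_def fun_eq_iff)
      with gt \<epsilon>[OF real_distribution_average_measure[where \<nu>="\<lambda>t. \<xi> t \<omega>", OF dist n]] have "\<not> ?LP n \<omega> < \<epsilon>"
        by (auto simp del: One_nat_def)
      then show "\<epsilon> / 2 * 1 < \<bar>?LP n \<omega>\<bar>" using \<open>0 < \<epsilon>\<close> by linarith
    qed
  qed simp
qed

theorem theorem4:
  fixes M :: "'a measure"
    and \<xi> :: "nat \<Rightarrow> 'a \<Rightarrow> real measure"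
    and X :: "real \<Rightarrow> 'a \<Rightarrow> real"
    and \<mu> :: "real measure"
    and q :: "nat \<Rightarrow> nat"
    and s :: "nat \<Rightarrow> nat \<Rightarrow> real"
  assumes "prob_space M"
    and "stationary_process M (prob_algebra borel) \<xi>"
    and "conjugate_process M \<xi> X"
    and "cyclic_independent M \<xi> X"
    and "diffraction M \<xi> \<mu>"
    and "\<And>t. 1 \<le> q t"
    and "\<And>t i. i \<in> {1..q t} \<Longrightarrow> s t i \<in> {real t..<real t + 1}"
    and "ergodic_in_prob M \<xi>"
  shows
    "small_o_P M (\<lambda>n \<omega>. L2_norm \<mu> (\<lambda>x. mean_cdf \<xi> n \<omega> x - cdf (baricenter M (\<xi> 0)) x)) (\<lambda>n. 1) \<and>
     small_o_P M (\<lambda>n \<omega>. L2_norm \<mu> (\<lambda>x. mean_sample_cdf X q s n \<omega> x - cdf (baricenter M (\<xi> 0)) x)) (\<lambda>n. 1) \<and>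
     (big_O_P M (\<lambda>n \<omega>. L2_norm \<mu> (\<lambda>x. mean_cdf \<xi> n \<omega> x - cdf (baricenter M (\<xi> 0)) x)) (\<lambda>n. 1 / sqrt (real n)) \<longrightarrow>
      big_O_P M (\<lambda>n \<omega>. L2_norm \<mu> (\<lambda>x. mean_sample_cdf X q s n \<omega> x - cdf (baricenter M (\<xi> 0)) x)) (\<lambda>n. 1 / sqrt (real n)))"
proof -
  interpret prob_space M by fact
  have \<xi>: "\<xi> t \<in> M \<rightarrow>\<^sub>M prob_algebra borel" for t
    using assms(2) by (simp add: stationary_process_def)
  have sets_\<mu> [measurable_cong]: "sets \<mu> = sets borel" and fin: "finite_measure \<mu>"
    using assms(5) by (auto simp: diffraction_def)
  interpret \<mu>: finite_measure \<mu> by fact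
  define m where "m = baricenter M (\<xi> 0)"
  have m: "real_distribution m"
    unfolding m_def using assms(1) \<xi> by (rule real_distribution_baricenter)
  interpret m: real_distribution m by fact
  \<comment> \<open>\<open>U n\<close> is the error due to sampling, \<open>V n\<close> the error of the average of the random distribution
    functions themselves.\<close>
  define D where "D t \<omega> x = sample_cdf X q s t \<omega> x - cdf (\<xi> t \<omega>) x" for t \<omega> x
  define U where "U n \<omega> x = (\<Sum>t=1..n. D t \<omega> x) / real n" for n \<omega> x
  define V where "V n \<omega> x = mean_cdf \<xi> n \<omega> x - cdf m x" for n \<omega> x
  have X: "X (s t i) \<in> borel_measurable M" if "i \<in> {1..q t}" for t i
    using assms(3) assms(7)[OF that] by (auto simp: conjugate_process_def)
  have D_meas [measurable]: "case_prod (D t) \<in> borel_measurable (M \<Otimes>\<^sub>M borel)" for t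
    using borel_measurable_diff[OF borel_measurable_sample_cdf[of q t X s M, OF X] borel_measurable_random_cdf[OF \<xi>[of t]]]
    by (simp add: D_def split_beta')
  have F: "0 \<le> cdf (\<xi> t \<omega>) x" "cdf (\<xi> t \<omega>) x \<le> 1" and
    F_meas: "cdf (\<xi> t \<omega>) \<in> borel_measurable borel" if "\<omega> \<in> space M" for t \<omega> x
  proof -
    have dist: "real_distribution (\<xi> t \<omega>)"
      using measurable_space[OF \<xi> that] by (simp add: real_distribution_iff_prob_algebra)
    show "0 \<le> cdf (\<xi> t \<omega>) x" by (simp add: cdf_def)
    show "cdf (\<xi> t \<omega>) x \<le> 1" using dist by (rule real_distribution.cdf_le_1)
    show "cdf (\<xi> t \<omega>) \<in> borel_measurable borel" using dist by (rule real_distribution.borel_measurable_cdf)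
  qed
  have D_le: "\<bar>D t \<omega> x\<bar> \<le> 1" if "\<omega> \<in> space M" for t \<omega> x
    using F[OF that, of t x] sample_cdf_bounds[of X q s t \<omega> x] by (simp add: D_def abs_le_iff)
  have noise: "big_O_P M (\<lambda>n \<omega>. L2_norm \<mu> (U n \<omega>)) (\<lambda>n. 1 / sqrt (real n))"
    unfolding U_def
  proof (rule big_O_P_L2_norm_average_uncorrelated[OF assms(1) fin sets_\<mu> D_meas D_le])
    show "(\<integral>\<omega>. D t \<omega> x * D u \<omega> x \<partial>M) = 0" if "t \<noteq> u" for t u x
      unfolding D_def
      using assms(1) \<xi> assms(3,4,6,7) that by (rule sampling_errors_uncorrelated)
  qed
  have "(\<lambda>n. 1 / sqrt (real n)) \<longlonglongrightarrow> 0"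
    by (intro real_tendsto_divide_at_top[OF tendsto_const] filterlim_compose[OF sqrt_at_top]
        filterlim_real_sequentially)
  with noise have noise': "small_o_P M (\<lambda>n \<omega>. L2_norm \<mu> (U n \<omega>)) (\<lambda>_. 1)"
    by (rule big_O_P_imp_small_o_P)
  have signal: "small_o_P M (\<lambda>n \<omega>. L2_norm \<mu> (V n \<omega>)) (\<lambda>_. 1)"
    unfolding V_def
    using \<xi> m fin sets_\<mu> diffraction_countable_null[OF assms(5)] assms(8)
    unfolding ergodic_in_prob_def m_def by (rule small_o_P_mean_cdf)
  have norm: "\<bar>L2_norm \<mu> (\<lambda>x. mean_sample_cdf X q s n \<omega> x - cdf m x)\<bar>
      \<le> 2 * max \<bar>L2_norm \<mu> (U n \<omega>)\<bar> \<bar>L2_norm \<mu> (V n \<omega>)\<bar>" if \<omega>: "\<omega> \<in> space M" for n \<omega>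
  proof -
    have sq_int: "integrable \<mu> (\<lambda>x. (f x)\<^sup>2)"
      if "f \<in> borel_measurable borel" "\<And>x. \<bar>f x\<bar> \<le> 2" for f :: "real \<Rightarrow> real"
    proof (rule \<mu>.integrable_const_bound[where B=4])
      have "(f x)\<^sup>2 \<le> 4" for x using power_mono[OF that(2), of x 2] by simp
      then show "AE x in \<mu>. norm ((f x)\<^sup>2) \<le> 4" by simp
    qed (use that(1) in measurable)
    have [measurable]: "D t \<omega> \<in> borel_measurable borel" for t
      using measurable_compose[OF measurable_Pair1'[OF \<omega>] D_meas[of t]] by simp
    have U_int: "integrable \<mu> (\<lambda>x. (U n \<omega> x)\<^sup>2)"
    proof (rule sq_int)
      show "U n \<omega> \<in> borel_measurable borel" unfolding U_def by measurable
      show "\<bar>U n \<omega> x\<bar> \<le> 2" for x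
        using abs_average_le_1[of "\<lambda>t. D t \<omega> x" n, OF D_le[OF \<omega>]] unfolding U_def by linarith
    qed
    have V_int: "integrable \<mu> (\<lambda>x. (V n \<omega> x)\<^sup>2)"
    proof (rule sq_int)
      note [measurable] = F_meas[OF \<omega>]
      show "V n \<omega> \<in> borel_measurable borel" unfolding V_def mean_cdf_def by measurable
      show "\<bar>V n \<omega> x\<bar> \<le> 2" for x
      proof -
        have "\<bar>mean_cdf \<xi> n \<omega> x\<bar> \<le> 1"
          unfolding mean_cdf_def using F[OF \<omega>, of _ x] by (intro abs_average_le_1) simp
        then show ?thesis
          using m.cdf_nonneg[of x] m.cdf_le_1[of x] unfolding V_def by linarith
      qed
    qed
    have "mean_sample_cdf X q s n \<omega> x - cdf m x = U n \<omega> x + V n \<omega> x" for x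
      by (simp add: U_def V_def D_def mean_sample_cdf_def mean_cdf_def sum_subtractf diff_divide_distrib)
    then show ?thesis using L2_norm_add_quasi_triangle[OF U_int V_int] by simp
  qed
  show ?thesis
    using signal small_o_P_quasi_triangle[OF norm noise' signal]
      big_O_P_quasi_triangle[OF norm _ noise]
    unfolding V_def m_def by simp
qed

end
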